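(* Let $T$ be a finite tree with $k=\mathrm{pw}(T)$, $s\in V(T)$ a prediction, $t\in V(T)$ the hidden target, and $D=\mathrm{dist}_T(s,t)$. Then the $k$-Spine Exponential Search algorithm (described in the context), run with any fixed $k$-spine decomposition of $T$, makes $O(k\log D)$ oracle queries.
   Context: Direction oracle for target $t$: querying $v\in V(T)$ returns "here" if $v=t$, and otherwise the unique neighbor of $v$ on the path in $T$ from $v$ to $t$. $\mathrm{dist}_T(u,v)$ is the number of edges on the $u$–$v$ path in $T$. Pathwidth $\mathrm{pw}$ is the usual graph pathwidth (minimum over path decompositions $B_1,\dots,B_m$ — vertex sets covering all vertices, every edge inside some bag, each vertex's bags forming an interval — of $\max|B_i|-1$); a tree has pathwidth $0$ iff it is a single vertex. For a tree $T$ with $\mathrm{pw}(T)=k\ge1$, a $k$-spine of $T$ is a path $P$ in $T$ such that every connected component of $T\setminus V(P)$ has pathwidth at most $k-1$. A $k$-spine decomposition is obtained recursively: remove a $k$-spine of $T$, then recursively remove a $\mathrm{pw}(C)$-spine from each connected component $C$ of what remains, stopping at singleton components; thus each component arising in the recursion has a designated spine. $k$-Spine Exponential Search: maintain a current component $T_{cur}$ (initially $T$) and start vertex $s_{cur}$ (initially $s$). While $T_{cur}$ is not a single vertex: let $P$ be the designated spine of $T_{cur}$; let $a$ be the vertex of $P$ closest to $s_{cur}$; run exponential (doubling binary) search on the path $P$ starting from $a$, using oracle answers as directions along $P$, until either "here" is returned (then return that vertex) or the oracle at some $x\in P$ returns a neighbor $y\notin P$; in the latter case set $T_{cur}$ to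 the component of $T_{cur}\setminus V(P)$ containing $y$ and $s_{cur}:=y$. When $T_{cur}$ is a single vertex, return it. Exponential search on a path from $a$ finds an unknown vertex $x$ of the path using $O(\log(\mathrm{dist}_P(a,x)+1))$ queries.
   Formalization: On descending to a new component, the start vertex stays s_cur if s_cur lies in it and becomes y only otherwise (always resetting to y makes the bound false, e.g. on a spider with three long legs); log D is read as max(1, log₂ D), since log D is 0 or undefined for D ≤ 1. *)

theory Defs
  imports Complex_Main "Graph_Theory.Graph_Theory"
begin

section \<open>Trees\<close>

text \<open>
  Undirected simple finite graphs are symmetric digraphs (locale \<^term>\<open>graph\<close>).  The library
  predicate \<^const>\<open>tree\<close> is unsuitable for them: in a symmetric digraph every edge traversed
  back and forth is a \<^const>\<open>pre_digraph.cycle\<close> of length 2.  A cycle of the undirected graph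
  is one of length at least 3.
\<close>

definition undirected_tree :: "('a, 'b) pre_digraph \<Rightarrow> bool" where
  "undirected_tree T \<longleftrightarrow>
     graph T \<and> Digraph_Component.connected T \<and>
     \<not> (\<exists>c. pre_digraph.cycle T c \<and> 3 \<le> length c)"

definition tree_path :: "('a, 'b) pre_digraph \<Rightarrow> 'a \<Rightarrow> 'a \<Rightarrow> 'a list" where
  "tree_path T u v = (THE p. vpath p T \<and> hd p = u \<and> last p = v)"

definition tree_dist :: "('a, 'b) pre_digraph \<Rightarrow> 'a \<Rightarrow> 'a \<Rightarrow> nat" where
  "tree_dist T u v = vwalk_length (tree_path T u v)"

text \<open>In a symmetric digraph the strongly connected components are the connected components.\<close>

abbreviation components :: "('a, 'b) pre_digraph \<Rightarrow> 'a set set" where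
  "components G \<equiv> pre_digraph.sccs_verts G"

abbreviation component_of :: "('a, 'b) pre_digraph \<Rightarrow> 'a \<Rightarrow> 'a set" where
  "component_of G v \<equiv> pre_digraph.scc_of G v"


section \<open>Pathwidth\<close>

definition path_decomposition :: "('a, 'b) pre_digraph \<Rightarrow> 'a set list \<Rightarrow> bool" where
  "path_decomposition G Bs \<longleftrightarrow>
     Bs \<noteq> [] \<and>
     \<Union> (set Bs) = verts G \<and>
     (\<forall>(u, v) \<in> arcs_ends G. \<exists>B \<in> set Bs. u \<in> B \<and> v \<in> B) \<and>
     (\<forall>i j l. i \<le> j \<and> j \<le> l \<and> l < length Bs \<longrightarrow> Bs ! i \<inter> Bs ! l \<subseteq> Bs ! j)"

definition decomposition_width :: "'a set list \<Rightarrow> nat" where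
  "decomposition_width Bs = Max (card ` set Bs) - 1"

definition pathwidth :: "('a, 'b) pre_digraph \<Rightarrow> nat" where
  "pathwidth G = (LEAST w. \<exists>Bs. path_decomposition G Bs \<and> decomposition_width Bs = w)"


section \<open>Spine decompositions\<close>

definition is_spine :: "('a, 'b) pre_digraph \<Rightarrow> nat \<Rightarrow> 'a list \<Rightarrow> bool" where
  "is_spine G k p \<longleftrightarrow>
     vpath p G \<and>
     (\<forall>C \<in> components (G \<restriction> (verts G - set p)). pathwidth (G \<restriction> C) \<le> k - 1)"

text \<open>
  A decomposition is given by the map \<open>\<sigma>\<close> from the (vertex sets of the) components arising in the
  recursion to their designated spines.  Its values on other sets are irrelevant.
\<close>

inductive_set arising_components ::
  "('a, 'b) pre_digraph \<Rightarrow> ('a set \<Rightarrow> 'a list) \<Rightarrow> 'a set set"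
  for T :: "('a, 'b) pre_digraph" and \<sigma> :: "'a set \<Rightarrow> 'a list"
where
  whole: "verts T \<in> arising_components T \<sigma>"
| part: "\<lbrakk>C \<in> arising_components T \<sigma>; \<not> is_singleton C;
    C' \<in> components (T \<restriction> (C - set (\<sigma> C)))\<rbrakk> \<Longrightarrow> C' \<in> arising_components T \<sigma>"

definition spine_decomposition :: "('a, 'b) pre_digraph \<Rightarrow> ('a set \<Rightarrow> 'a list) \<Rightarrow> bool" where
  "spine_decomposition T \<sigma> \<longleftrightarrow>
     (\<forall>C \<in> arising_components T \<sigma>. \<not> is_singleton C \<longrightarrow>
        is_spine (T \<restriction> C) (pathwidth (T \<restriction> C)) (\<sigma> C))"


section \<open>The direction oracle\<close>

datatype 'a answer = Here | Toward 'a

definition direction_oracle :: "('a, 'b) pre_digraph \<Rightarrow> 'a \<Rightarrow> 'a \<Rightarrow> 'a answer" where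
  "direction_oracle T t v = (if v = t then Here else Toward (tree_path T v t ! 1))"


section \<open>Exponential search on a path\<close>

text \<open>
  Positions on the path \<open>p\<close> are list indices.  \<open>Stop\<close> means that the oracle answered \<open>Here\<close> or
  pointed off the path.  All search procedures return the stopping position (or vertex) together
  with the number of oracle queries made; each evaluation of \<open>mv\<close> is one query.  The result
  \<^const>\<open>None\<close> stands for nontermination.
\<close>

datatype move = Backward | Stop | Forward

definition path_move :: "('a \<Rightarrow> 'a answer) \<Rightarrow> 'a list \<Rightarrow> nat \<Rightarrow> move" where
  "path_move ask p i =
     (case ask (p ! i) of
        Here \<Rightarrow> Stop
      | Toward y \<Rightarrow>
          if i + 1 < length p \<and> y = p ! (i + 1) then Forward
          else if 0 < i \<and> y = p ! (i - 1) then Backward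
          else Stop)"

text \<open>Here \<open>mv\<close> is known to answer \<open>Forward\<close> at \<open>lo\<close> and \<open>Backward\<close> at \<open>hi\<close>.\<close>

partial_function (option) binary_search ::
  "(nat \<Rightarrow> move) \<Rightarrow> nat \<Rightarrow> nat \<Rightarrow> nat \<Rightarrow> (nat \<times> nat) option"
where
  "binary_search mv lo hi q =
     (let m = (lo + hi) div 2 in
      case mv m of
        Stop \<Rightarrow> Some (m, q + 1)
      | Forward \<Rightarrow> binary_search mv m hi (q + 1)
      | Backward \<Rightarrow> binary_search mv lo m (q + 1))"

text \<open>
  Probes the positions \<open>a + 1, a + 2, a + 4, \<dots>\<close>, truncated at the end of a path with \<open>n\<close> vertices;
  \<open>lo\<close> is the last position where \<open>mv\<close> is known to answer \<open>Forward\<close>.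
\<close>

partial_function (option) doubling_search ::
  "(nat \<Rightarrow> move) \<Rightarrow> nat \<Rightarrow> nat \<Rightarrow> nat \<Rightarrow> nat \<Rightarrow> nat \<Rightarrow> (nat \<times> nat) option"
where
  "doubling_search mv n a d lo q =
     (let m = min (a + d) (n - 1) in
      case mv m of
        Stop \<Rightarrow> Some (m, q + 1)
      | Forward \<Rightarrow> doubling_search mv n a (2 * d) m (q + 1)
      | Backward \<Rightarrow> binary_search mv lo m (q + 1))"

definition forward_search :: "('a \<Rightarrow> 'a answer) \<Rightarrow> 'a list \<Rightarrow> nat \<Rightarrow> nat \<Rightarrow> ('a \<times> nat) option" where
  "forward_search ask p a q =
     map_option (\<lambda>(i, q'). (p ! i, q')) (doubling_search (path_move ask p) (length p) a 1 a q)"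

definition exponential_search :: "('a \<Rightarrow> 'a answer) \<Rightarrow> 'a list \<Rightarrow> nat \<Rightarrow> ('a \<times> nat) option" where
  "exponential_search ask p a =
     (case path_move ask p a of
        Stop \<Rightarrow> Some (p ! a, 1)
      | Forward \<Rightarrow> forward_search ask p a 1
      | Backward \<Rightarrow> forward_search ask (rev p) (length p - 1 - a) 1)"


section \<open>Spine exponential search\<close>

definition closest_position :: "('a, 'b) pre_digraph \<Rightarrow> 'a list \<Rightarrow> 'a \<Rightarrow> nat" where
  "closest_position T p s = arg_min_on (\<lambda>i. tree_dist T s (p ! i)) {..<length p}"

text \<open>
  \<open>C\<close> and \<open>s\<close> are the current component and start vertex, \<open>q\<close> the number of queries made so far.
  The inspection of \<open>ask x\<close> reuses the answer on which the exponential search stopped, hence is not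
  counted again.

  When the search moves on to the component \<open>C'\<close> of \<open>y\<close>, the new start vertex is the vertex of
  \<open>C'\<close> closest to \<open>s\<close>: this is \<open>y\<close> if \<open>s\<close> lies outside \<open>C'\<close>, and \<open>s\<close> itself otherwise.
  Resetting it to \<open>y\<close> also when \<open>s \<in> C'\<close> would lose the prediction: on a spider with three legs
  of length \<open>n\<close> whose designated spine is the centre alone, with \<open>s\<close> and \<open>t\<close> at distance 2 near the
  end of one leg, the search would restart at the beginning of that leg and need about
  \<open>log n\<close> queries.
\<close>

partial_function (option) spine_search_from ::
  "('a, 'b) pre_digraph \<Rightarrow> ('a \<Rightarrow> 'a answer) \<Rightarrow> ('a set \<Rightarrow> 'a list) \<Rightarrow>
   'a set \<Rightarrow> 'a \<Rightarrow> nat \<Rightarrow> ('a \<times> nat) option"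
where
  "spine_search_from T ask \<sigma> C s q =
     (if is_singleton C then Some (the_elem C, q)
      else Option.bind (exponential_search ask (\<sigma> C) (closest_position T (\<sigma> C) s))
        (\<lambda>(x, q').
           case ask x of
             Here \<Rightarrow> Some (x, q + q')
           | Toward y \<Rightarrow>
               (let C' = component_of (T \<restriction> (C - set (\<sigma> C))) y in
                spine_search_from T ask \<sigma> C' (if s \<in> C' then s else y) (q + q'))))"

definition spine_exponential_search ::
  "('a, 'b) pre_digraph \<Rightarrow> ('a set \<Rightarrow> 'a list) \<Rightarrow> 'a \<Rightarrow> 'a \<Rightarrow> ('a \<times> nat) option"
where
  "spine_exponential_search T \<sigma> s t =
     spine_search_from T (direction_oracle T t) \<sigma> (verts T) s 0"

end

theory Submission
  imports Defs
begin

text \<open>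
  Paths in a tree are unique, so every vertex reaches a path \<open>P\<close> at a well-defined vertex.  Let \<open>a\<close>
  and \<open>x\<close> be these entry points for the current start vertex \<open>s\<close> and the target \<open>t\<close>.  Then \<open>a\<close> is
  the vertex of \<open>P\<close> closest to \<open>s\<close>, the oracle answers on \<open>P\<close> point to \<open>x\<close>, and if \<open>a \<noteq> x\<close> the path
  from \<open>s\<close> to \<open>t\<close> runs along \<open>P\<close> from \<open>a\<close> to \<open>x\<close>; so one exponential search from \<open>a\<close> costs
  logarithmically many queries in the distance of \<open>s\<close> and \<open>t\<close>.  If \<open>s\<close> is not in the component of
  \<open>t\<close> off the spine, then the path from \<open>s\<close> to \<open>t\<close> enters that component at the new start
  vertex \<open>y\<close>, so the distance to \<open>t\<close> never grows.  The pathwidth drops in every round, and a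
  connected graph of pathwidth 0 is a single vertex, which bounds the number of rounds.
\<close>

section \<open>Searching a path\<close>

text \<open>Reduces the oracle on a path to a function of positions, so that the searches can be
  analysed without any tree.\<close>

definition points_to :: "(nat \<Rightarrow> move) \<Rightarrow> nat \<Rightarrow> nat \<Rightarrow> bool" where
  "points_to mv n x \<longleftrightarrow> x < n \<and>
     (\<forall>i<n. mv i = (if i < x then Forward else if i = x then Stop else Backward))"

text \<open>Each query at the midpoint halves the gap. The bounds are strict, so a gap of 1 cannot
  contain \<open>x\<close> and the base case is vacuous.\<close>

lemma binary_search_queries:
  assumes "points_to mv n x" "lo < x" "x < hi" "hi < n" "hi - lo \<le> 2 ^ j"
  shows "\<exists>q'\<le>j. binary_search mv lo hi q = Some (x, q + q')"
  using assms(2-)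
proof (induction j arbitrary: lo hi q)
  case 0
  then show ?case by simp
next
  case (Suc j)
  define m where "m = (lo + hi) div 2"
  have step: "binary_search mv lo hi q = (case mv m of Stop \<Rightarrow> Some (m, q + 1)
      | Forward \<Rightarrow> binary_search mv m hi (q + 1) | Backward \<Rightarrow> binary_search mv lo m (q + 1))"
    by (subst binary_search.simps) (simp only: Let_def m_def)
  have m: "lo < m" "m < hi" "m - lo \<le> 2 ^ j" "hi - m \<le> 2 ^ j"
    using Suc.prems unfolding m_def by auto
  have mv: "mv m = (if m < x then Forward else if m = x then Stop else Backward)"
    using assms(1) m(2) Suc.prems by (simp add: points_to_def)
  consider "m = x" | "m < x" | "x < m" by linarith
  then show ?case
  proof cases
    case 1
    then show ?thesis
      using mv by (auto simp: step)
  next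
    case 2
    obtain q' where "q' \<le> j" "binary_search mv m hi (q + 1) = Some (x, q + 1 + q')"
      using Suc.IH[of m hi "q + 1"] 2 m Suc.prems by auto
    then show ?thesis
      using mv 2 by (auto simp: step intro!: exI[of _ "Suc q'"])
  next
    case 3
    obtain q' where "q' \<le> j" "binary_search mv lo m (q + 1) = Some (x, q + 1 + q')"
      using Suc.IH[of lo m "q + 1"] 3 m Suc.prems by auto
    then show ?thesis
      using mv 3 by (auto simp: step intro!: exI[of _ "Suc q'"])
  qed
qed

text \<open>\<open>k\<close> counts the doublings left until the radius \<open>2 ^ (j + k)\<close>
  reaches \<open>x\<close>. The bound allows \<open>Suc k\<close> probes and at most
  \<open>j + k\<close> halvings, because the final gap never exceeds the last radius probed.\<close>

lemma doubling_search_queries: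
  assumes "points_to mv n x" "a \<le> lo" "lo < x" "x \<le> a + 2 ^ (j + k)"
  shows "\<exists>q'\<le>Suc k + (j + k). doubling_search mv n a (2 ^ j) lo q = Some (x, q + q')"
  using assms(2-)
proof (induction k arbitrary: j lo q)
  case 0
  define m where "m = min (a + 2 ^ j) (n - 1)"
  have step: "doubling_search mv n a (2 ^ j) lo q = (case mv m of Stop \<Rightarrow> Some (m, q + 1)
      | Forward \<Rightarrow> doubling_search mv n a (2 * 2 ^ j) m (q + 1)
      | Backward \<Rightarrow> binary_search mv lo m (q + 1))"
    by (subst doubling_search.simps) (simp only: Let_def m_def)
  have m: "x \<le> m" "m < n" "m - lo \<le> 2 ^ j"
    using 0 assms(1) unfolding m_def by (auto simp: points_to_def)
  have mv: "mv m = (if m = x then Stop else Backward)"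
    using assms(1) m by (auto simp: points_to_def)
  show ?case
  proof (cases "m = x")
    case True
    then show ?thesis
      using mv by (auto simp: step)
  next
    case False
    obtain q' where "q' \<le> j" "binary_search mv lo m (q + 1) = Some (x, q + 1 + q')"
      using binary_search_queries[OF assms(1), of lo m j "q + 1"] False m 0 by auto
    then show ?thesis
      using mv False by (auto simp: step intro!: exI[of _ "Suc q'"])
  qed
next
  case (Suc k)
  define m where "m = min (a + 2 ^ j) (n - 1)"
  have step: "doubling_search mv n a (2 ^ j) lo q = (case mv m of Stop \<Rightarrow> Some (m, q + 1)
      | Forward \<Rightarrow> doubling_search mv n a (2 * 2 ^ j) m (q + 1)
      | Backward \<Rightarrow> binary_search mv lo m (q + 1))"
    by (subst doubling_search.simps) (simp only: Let_def m_def)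
  \<comment> \<open>If \<open>m < x\<close>, then \<open>m\<close> is not the truncated value
    \<open>n - 1\<close>, so it equals \<open>a + 2 ^ j\<close>.\<close>
  have m: "m < n" "m - lo \<le> 2 ^ j" "m < x \<Longrightarrow> a \<le> m"
    using Suc.prems assms(1) unfolding m_def by (auto simp: points_to_def)
  have mv: "mv m = (if m < x then Forward else if m = x then Stop else Backward)"
    using assms(1) m by (auto simp: points_to_def)
  consider "m = x" | "m < x" | "x < m" by linarith
  then show ?case
  proof cases
    case 1
    then show ?thesis
      using mv by (auto simp: step)
  next
    case 2
    obtain q' where "q' \<le> Suc k + (Suc j + k)"
        "doubling_search mv n a (2 ^ Suc j) m (q + 1) = Some (x, q + 1 + q')"
      using Suc.IH[of m "Suc j" "q + 1"] 2 m Suc.prems by auto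
    then show ?thesis
      using mv 2 by (auto simp: step intro!: exI[of _ "Suc q'"])
  next
    case 3
    obtain q' where "q' \<le> j" "binary_search mv lo m (q + 1) = Some (x, q + 1 + q')"
      using binary_search_queries[OF assms(1), of lo m j "q + 1"] 3 m Suc.prems by auto
    then show ?thesis
      using mv 3 by (auto simp: step intro!: exI[of _ "Suc q'"])
  qed
qed

lemma forward_search_queries:
  assumes "points_to (path_move ask p) (length p) x" "a < x" "x \<le> a + 2 ^ N"
  shows "\<exists>q'\<le>2 * N + 1. forward_search ask p a q = Some (p ! x, q + q')"
  using doubling_search_queries[OF assms(1), of a a 0 N q] assms(2,3)
  by (fastforce simp: forward_search_def)

text \<open>A search backward from \<open>a\<close> is a forward search on \<open>rev p\<close>,
  where index \<open>i\<close> becomes \<open>length p - 1 - i\<close> and differences are kept;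
  hence the hypothesis on \<open>rev p\<close>. The query at \<open>a\<close> itself raises
  \<open>2 * N + 1\<close> to \<open>2 * N + 2\<close>.\<close>

lemma exponential_search_queries:
  assumes fw: "points_to (path_move ask p) (length p) x"
    and bw: "points_to (path_move ask (rev p)) (length p) (length p - 1 - x)"
    and "a < length p" "x \<le> a + 2 ^ N" "a \<le> x + 2 ^ N"
  shows "\<exists>q\<le>2 * N + 2. exponential_search ask p a = Some (p ! x, q)"
proof -
  have x: "x < length p"
    using fw by (simp add: points_to_def)
  have mv: "path_move ask p a = (if a < x then Forward else if a = x then Stop else Backward)"
    using fw assms(3) by (simp add: points_to_def)
  consider "a = x" | "a < x" | "x < a" by linarith
  then show ?thesis
  proof cases
    case 1
    then show ?thesis
      using mv by (simp add: exponential_search_def)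
  next
    case 2
    obtain q' where "q' \<le> 2 * N + 1" "forward_search ask p a 1 = Some (p ! x, 1 + q')"
      using forward_search_queries[OF fw 2 assms(4)] by blast
    then show ?thesis
      using mv 2 by (simp add: exponential_search_def)
  next
    case 3
    have "length p - 1 - a < length p - 1 - x" "length p - 1 - x \<le> length p - 1 - a + 2 ^ N"
      using 3 assms(3,5) by linarith+
    then obtain q' where "q' \<le> 2 * N + 1"
        "forward_search ask (rev p) (length p - 1 - a) 1 = Some (rev p ! (length p - 1 - x), 1 + q')"
      using forward_search_queries[of ask "rev p" "length p - 1 - x" "length p - 1 - a" N 1]
        bw by (metis length_rev)
    moreover have "rev p ! (length p - 1 - x) = p ! x"
      using x by (simp add: rev_nth)
    ultimately show ?thesis
      using mv 3 by (simp add: exponential_search_def)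
  qed
qed

section \<open>Paths in trees\<close>

lemma vwalk_append_iff:
  assumes "p \<noteq> []" "q \<noteq> []"
  shows "vwalk (p @ q) G \<longleftrightarrow> vwalk p G \<and> vwalk q G \<and> (last p, hd q) \<in> arcs_ends G"
  using assms by (auto simp: vwalk_def vwalk_arcs_append)

text \<open>Bridges two notions: paths are lists of vertices, whereas \<open>cycle\<close> speaks of
  lists of arcs.\<close>

lemma (in wf_digraph) vwalk_imp_awalk:
  assumes "vwalk p G"
  shows "\<exists>es. awalk (hd p) es (last p) \<and> awalk_verts (hd p) es = p"
  using assms
proof (induction p rule: vwalk_induct)
  case (Base u)
  then show ?case by (auto intro!: exI[of _ "[]"] simp: awalk_Nil_iff)
next
  case (Cons u v ws)
  then obtain es e where "awalk v es (last (v # ws))" "awalk_verts v es = v # ws"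
      "e \<in> arcs G" "tail G e = u" "head G e = v"
    by (auto simp: arcs_ends_conv)
  then show ?case
    by (intro exI[of _ "e # es"]) (auto simp: awalk_Cons_iff)
qed

lemma (in wf_digraph) arcs_ends_induce:
  "arcs_ends (G \<restriction> S) = arcs_ends G \<inter> S \<times> S"
  by (auto simp: arcs_ends_conv)

lemma (in wf_digraph) vwalk_induce_iff:
  assumes "S \<subseteq> verts G"
  shows "vwalk p (G \<restriction> S) \<longleftrightarrow> vwalk p G \<and> set p \<subseteq> S"
  using assms arcs_in_vwalk_arcs[of _ p]
  by (fastforce simp: vwalk_def arcs_ends_induce)

lemma (in wf_digraph) vpath_induce_iff:
  assumes "S \<subseteq> verts G"
  shows "vpath p (G \<restriction> S) \<longleftrightarrow> vpath p G \<and> set p \<subseteq> S"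
  using vwalk_induce_iff[OF assms] by (auto simp: vpath_def)

section \<open>Uniqueness of paths\<close>

locale tree_graph = graph T for T :: "('a, 'b) pre_digraph" +
  assumes cycle_short: "cycle c \<Longrightarrow> length c < 3"
begin

lemma vpath_rev: "vpath p T \<Longrightarrow> vpath (rev p) T"
  using vwalk_rev_ex[OF sym_arcs] by (auto simp: vpath_def)

text \<open>An edge from the last vertex to the first would close the path to a cycle with as many
  arcs as the path has vertices.\<close>

lemma vpath_ends_nonadjacent:
  assumes "vpath p T" "3 \<le> length p"
  shows "(last p, hd p) \<notin> arcs_ends T"
proof
  assume "(last p, hd p) \<in> arcs_ends T"
  then obtain e where e: "e \<in> arcs T" "tail T e = last p" "head T e = hd p"
    by (auto simp: arcs_ends_conv)
  obtain es where es: "awalk (hd p) es (last p)" "awalk_verts (hd p) es = p"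
    using vwalk_imp_awalk assms(1) by blast
  have walk: "awalk (hd p) (es @ [e]) (hd p)"
    using es e assms by (auto simp: awalk_Cons_iff awalk_Nil_iff)
  moreover have "awalk_verts (hd p) (es @ [e]) = p @ [hd p]"
    using awalk_verts_append[OF walk] es e by simp
  moreover have "distinct (tl (p @ [hd p]))"
    using assms by (cases p) auto
  ultimately have "cycle (es @ [e])"
    unfolding cycle_def by auto
  moreover have "length p = Suc (length es)"
    using es(2) by (metis length_awalk_verts)
  ultimately show False
    using cycle_short assms(2) by fastforce
qed

text \<open>Common first vertices are peeled off by induction. Where two paths part and meet again,
  they enclose a path with adjacent ends, which \<open>vpath_ends_nonadjacent\<close>
  forbids.\<close>

lemma vpath_unique:
  assumes "vpath p T" "vpath q T" "hd p = hd q" "last p = last q"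
  shows "p = q"
  using assms
proof (induction p arbitrary: q)
  case Nil
  then show ?case by (simp add: vpath_def vwalk_def)
next
  case (Cons u p)
  obtain q1 where q: "q = u # q1"
    using Cons.prems by (cases q) (auto simp: vpath_def vwalk_def)
  show ?case
  proof (cases "p = [] \<or> q1 = []")
    case True
    then show ?thesis
      using Cons.prems q by (auto simp: vpath_def split: if_splits)
  next
    case False
    then have ne: "p \<noteq> []" "q1 \<noteq> []" by auto
    have sub: "vpath p T" "vpath q1 T"
      using Cons.prems(1,2) ne unfolding q by (auto simp: vpath_def elim: vwalk_consE)
    show ?thesis
    proof (cases "hd p = hd q1")
      case True
      then show ?thesis
        using Cons.IH[of q1] Cons.prems sub ne q by simp
    next
      case heads: False
      have "\<exists>w \<in> set p. w \<in> set q1"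
        using Cons.prems ne q by (metis last_ConsR last_in_set)
      \<comment> \<open>\<open>w\<close> is the first vertex of \<open>p\<close> on
        \<open>q1\<close>; choosing the first one keeps \<open>c\<close> below free of
        repetitions.\<close>
      then obtain p1 w p2 where p: "p = p1 @ w # p2" "w \<in> set q1" "\<forall>v\<in>set p1. v \<notin> set q1"
        by (auto elim!: split_list_first_propE)
      obtain q2 q3 where q1: "q1 = q2 @ w # q3"
        using p(2) by (meson split_list)
      \<comment> \<open>Back along the second path from \<open>w\<close> to \<open>u\<close>, then
        along the first one until just before \<open>w\<close>.\<close>
      define c where "c = rev (u # q2 @ [w]) @ p1"
      have wq: "vwalk (rev (u # q2 @ [w])) T"
        using Cons.prems(2) vwalkI_append_l[of "u # q2 @ [w]" q3 T] vwalk_rev_ex[OF sym_arcs]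
        unfolding q q1 by (auto simp: vpath_def simp del: rev.simps)
      have wp: "vwalk ((u # p1) @ w # p2) T"
        using Cons.prems(1) unfolding p by (auto simp: vpath_def)
      then have up: "vwalk (u # p1) T" "(last (u # p1), w) \<in> arcs_ends T"
        by (subst (asm) vwalk_append_iff; simp)+
      have "vwalk c T"
        using wq up vwalk_append_iff[of "[u]" p1 T]
          vwalk_append_iff[of "rev (u # q2 @ [w])" p1 T]
        by (cases "p1 = []") (auto simp: c_def)
      moreover have "distinct c"
        using Cons.prems(1,2) p unfolding c_def q q1 by (auto simp: vpath_def)
      ultimately have "vpath c T"
        by auto
      \<comment> \<open>Different heads mean that \<open>p1\<close> and \<open>q2\<close> are not
        both empty.\<close>
      moreover have "3 \<le> length c"
        using heads unfolding c_def p q1 by (cases p1; cases q2) auto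
      moreover have "(last c, hd c) \<in> arcs_ends T"
        using up unfolding c_def by auto
      ultimately show ?thesis
        using vpath_ends_nonadjacent by blast
    qed
  qed
qed

lemma tree_path_eq:
  assumes "vpath p T" "hd p = u" "last p = v"
  shows "tree_path T u v = p"
  unfolding tree_path_def using assms vpath_unique by (intro the_equality) auto

lemma tree_dist_eq:
  assumes "vpath p T" "hd p = u" "last p = v"
  shows "tree_dist T u v = length p - 1"
  using tree_path_eq[OF assms] by (simp add: tree_dist_def)

section \<open>Segments of a path, and paths entering it from outside\<close>

lemma vpath_segment_forward:
  assumes "vpath p T" "i \<le> j" "j < length p"
  defines "s \<equiv> take (Suc j - i) (drop i p)"
  shows "vpath s T" "hd s = p ! i" "last s = p ! j" "set s \<subseteq> set p" "length s = Suc (j - i)"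
proof -
  have ne: "s \<noteq> []" and len: "length s = Suc (j - i)"
    using assms by auto
  have split: "p = take i p @ s @ drop (Suc j) p"
    using assms(2,3) unfolding s_def
    by (metis Suc_diff_le append_take_drop_id drop_drop le_Suc_eq le_add_diff_inverse2)
  then have "vwalk (take i p @ s @ drop (Suc j) p) T" "distinct (take i p @ s @ drop (Suc j) p)"
    using assms(1) by (auto simp: vpath_def)
  then show "vpath s T"
    using ne by (metis append_is_Nil_conv distinct_append vpathI vwalkI_append_l vwalkI_append_r)
  show "length s = Suc (j - i)" by fact
  show "hd s = p ! i" "last s = p ! j"
    using ne len assms(2,3) by (simp_all add: hd_conv_nth last_conv_nth s_def)
  show "set s \<subseteq> set p"
    unfolding s_def by (meson order_trans set_drop_subset set_take_subset)
qed

text \<open>\<open>(i - j) + (j - i)\<close> is the absolute difference, since subtraction on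
  naturals truncates. The facts on \<open>s ! 1\<close> later yield the oracle's answers.\<close>

lemma vpath_segment:
  assumes "vpath p T" "i < length p" "j < length p"
  obtains s where "vpath s T" "hd s = p ! i" "last s = p ! j" "set s \<subseteq> set p"
    "length s = Suc ((i - j) + (j - i))" "i < j \<Longrightarrow> s ! 1 = p ! (i + 1)" "j < i \<Longrightarrow> s ! 1 = p ! (i - 1)"
proof (cases "i \<le> j")
  case True
  note seg = vpath_segment_forward[OF assms(1) True assms(3)]
  show ?thesis
    using seg True assms by (intro that) auto
next
  case False
  then have "j \<le> i" by simp
  note seg = vpath_segment_forward[OF assms(1) this assms(2)]
  have "vpath (rev (take (Suc i - j) (drop j p))) T"
    using seg(1) by (rule vpath_rev)
  moreover have "rev (take (Suc i - j) (drop j p)) ! 1 = p ! (i - 1)"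
    using False seg(5) assms(2) by (simp add: rev_nth)
  ultimately show ?thesis
    using seg False assms(2) by (intro that[of "rev (take (Suc i - j) (drop j p))"]) (auto simp: hd_rev last_rev)
qed

text \<open>\<open>r\<close> omits the entry point \<open>z\<close>, so it is empty exactly when the
  starting vertex already lies on \<open>p\<close>. In either case that vertex is
  \<open>hd (r @ [z])\<close>.\<close>

definition entry_path :: "'a list \<Rightarrow> 'a list \<Rightarrow> 'a \<Rightarrow> bool" where
  "entry_path p r z \<longleftrightarrow> vpath (r @ [z]) T \<and> z \<in> set p \<and> set r \<inter> set p = {}"

text \<open>\<open>r\<close> avoids \<open>p\<close> and \<open>s\<close> stays on it, so no vertex
  repeats.\<close>

lemma entry_path_append:
  assumes "entry_path p r z" "vpath s T" "set s \<subseteq> set p" "hd s = z"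
  shows "vpath (r @ s) T"
proof (cases "r = []")
  case False
  have "s \<noteq> []"
    using assms(2) by (auto simp: vpath_def vwalk_def)
  then show ?thesis
    using assms False vwalk_append_iff[of r "[z]" T] vwalk_append_iff[of r s T]
    by (auto simp: entry_path_def vpath_def)
qed (use assms in simp)

text \<open>Following \<open>r\<close> and then \<open>p\<close> from \<open>z\<close> to
  \<open>z'\<close> must give the path \<open>r' @ [z']\<close>. So \<open>z\<close> lies on the
  latter, while \<open>r'\<close> avoids \<open>p\<close>.\<close>

lemma entry_path_unique:
  assumes "vpath p T" "entry_path p r z" "entry_path p r' z'" "hd (r @ [z]) = hd (r' @ [z'])"
  shows "z = z'"
proof -
  obtain i j where ij: "i < length p" "j < length p" "z = p ! i" "z' = p ! j"
    using assms(2,3) by (metis entry_path_def in_set_conv_nth)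
  obtain s where s: "vpath s T" "hd s = z" "last s = z'" "set s \<subseteq> set p" "length s = Suc ((i - j) + (j - i))"
    using vpath_segment[OF assms(1) ij(1,2)] ij by metis
  then have ne: "s \<noteq> []" by auto
  have "r @ s = r' @ [z']"
    using entry_path_append[OF assms(2) s(1,4,2)] assms(3,4) s ne
    by (intro vpath_unique) (auto simp: entry_path_def hd_append)
  moreover have "z \<in> set s"
    using s(2) ne by auto
  ultimately have "z \<in> set (r' @ [z'])"
    by (metis Un_iff set_append)
  then show ?thesis
    using assms(2,3) by (auto simp: entry_path_def)
qed

lemma entry_path_suffix:
  assumes "entry_path p (r1 @ r2) z"
  shows "entry_path p r2 z"
  using assms vwalkI_append_r[of "r2 @ [z]" r1 T] by (auto simp: entry_path_def vpath_def)

text \<open>From a shared vertex on, both would be entry paths with the same start, hence with the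
  same entry point.\<close>

lemma entry_paths_disjoint:
  assumes "vpath p T" "entry_path p r z" "entry_path p r' z'" "z \<noteq> z'"
  shows "set r \<inter> set r' = {}"
proof (rule ccontr)
  assume "set r \<inter> set r' \<noteq> {}"
  then obtain w r1 r2 r1' r2' where "r = r1 @ w # r2" "r' = r1' @ w # r2'"
    by (metis Int_emptyI split_list)
  then show False
    using entry_path_suffix assms entry_path_unique[OF assms(1), of "w # r2" z "w # r2'" z']
    by (metis append_Cons list.sel(1))
qed

section \<open>Oracle answers along a path\<close>

lemma entry_path_target:
  assumes "vpath p T" "entry_path p r (p ! x)" "x < length p" "i < length p" "i \<noteq> x"
  shows "p ! i \<noteq> hd (r @ [p ! x])"
  using assms by (cases r) (auto simp: entry_path_def vpath_def nth_eq_iff_index_eq)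

text \<open>The tree path from \<open>p ! i\<close> to \<open>t\<close> runs along \<open>p\<close>
  to position \<open>x\<close> and then along \<open>rev r\<close>. Its second vertex is the
  neighbour on \<open>p\<close> towards \<open>x\<close> when \<open>i\<close> differs from
  \<open>x\<close>, and is off \<open>p\<close> when \<open>i = x\<close> and \<open>r\<close> is
  nonempty.\<close>

lemma path_move_points_to:
  assumes p: "vpath p T" and r: "entry_path p r (p ! x)" "x < length p" "hd (r @ [p ! x]) = t"
  shows "points_to (path_move (direction_oracle T t) p) (length p) x"
proof -
  have "path_move (direction_oracle T t) p i = (if i < x then Forward else if i = x then Stop else Backward)"
    if i: "i < length p" for i
  proof -
    obtain s where s: "vpath s T" "hd s = p ! x" "last s = p ! i" "set s \<subseteq> set p"
        "length s = Suc ((x - i) + (i - x))"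
      using vpath_segment[OF p r(2) i] by metis
    \<comment> \<open>The same segment in the other direction: \<open>s\<close> starts at the entry
      point, as \<open>entry_path_append\<close> requires, while \<open>s'\<close> exposes the first
      step from \<open>p ! i\<close>.\<close>
    obtain s' where s': "vpath s' T" "hd s' = p ! i" "last s' = p ! x"
        "length s' = Suc ((i - x) + (x - i))"
        "i < x \<Longrightarrow> s' ! 1 = p ! (i + 1)" "x < i \<Longrightarrow> s' ! 1 = p ! (i - 1)"
      using vpath_segment[OF p i r(2)] by metis
    have ss': "rev s = s'"
      using s s' vpath_rev by (intro vpath_unique) (auto simp: hd_rev last_rev)
    have ne: "s \<noteq> []" using s by auto
    have "tree_path T (p ! i) t = rev (r @ s)"
      using s(3) ne r(3) s(2)
      by (intro tree_path_eq vpath_rev entry_path_append[OF r(1) s(1,4,2)])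
        (auto simp: hd_rev last_rev hd_append)
    then have path: "tree_path T (p ! i) t = s' @ rev r"
      using ss' by simp
    show ?thesis
    proof (cases "i = x")
      case True
      then have s'_eq: "s' = [p ! x]"
        using s'(2,4) by (cases s') auto
      show ?thesis
      proof (cases "r = []")
        case True
        then show ?thesis
          using r(3) \<open>i = x\<close> by (simp add: path_move_def direction_oracle_def)
      next
        case False
        then have "tree_path T (p ! i) t ! 1 \<in> set r"
          using path s'_eq by (simp add: nth_append) (metis length_greater_0_conv length_rev nth_mem set_rev)
        then have "tree_path T (p ! i) t ! 1 \<notin> set p"
          using r(1) by (auto simp: entry_path_def)
        then show ?thesis
          using \<open>i = x\<close> i by (auto simp: path_move_def direction_oracle_def)
      qed
    next
      case False
      then have nt: "p ! i \<noteq> t"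
        using entry_path_target[OF p r(1,2) i] r(3) by simp
      have nxt: "tree_path T (p ! i) t ! 1 = s' ! 1"
        using path False s'(4) by (auto simp: nth_append)
      \<comment> \<open>\<open>path_move\<close> tests the forward neighbour first, so for
        \<open>x < i\<close> the two neighbours must be told apart.\<close>
      have "distinct p" using p by auto
      then have "x < i \<Longrightarrow> i + 1 < length p \<Longrightarrow> p ! (i - 1) \<noteq> p ! (i + 1)"
        by (simp add: nth_eq_iff_index_eq)
      then show ?thesis
        using False nt nxt s'(5,6) i r(2)
        by (cases i x rule: linorder_cases) (auto simp: path_move_def direction_oracle_def)
    qed
  qed
  then show ?thesis
    using r(2) by (simp add: points_to_def)
qed

section \<open>Distances through entry points\<close>

lemma tree_dist_entry_path:
  assumes "vpath p T" "entry_path p r (p ! a)" "a < length p" "i < length p"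
  shows "tree_dist T (hd (r @ [p ! a])) (p ! i) = length r + ((a - i) + (i - a))"
proof -
  obtain s where s: "vpath s T" "hd s = p ! a" "last s = p ! i" "set s \<subseteq> set p"
      "length s = Suc ((a - i) + (i - a))"
    using vpath_segment[OF assms(1,3,4)] by metis
  then have "s \<noteq> []" by auto
  then show ?thesis
    using tree_dist_eq[OF entry_path_append[OF assms(2) s(1,4,2)] refl refl] s
    by (cases "r = []") simp_all
qed

text \<open>The distance to position \<open>i\<close> is \<open>length r\<close> plus the distance
  of \<open>i\<close> from \<open>a\<close>, so the minimum is attained at \<open>a\<close> alone
  and \<open>arg_min_on\<close> leaves no choice.\<close>

lemma closest_position_entry_path:
  assumes "vpath p T" "entry_path p r (p ! a)" "a < length p" "hd (r @ [p ! a]) = s"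
  shows "closest_position T p s = a"
proof -
  let ?f = "\<lambda>i. tree_dist T s (p ! i)"
  let ?b = "closest_position T p s"
  have f: "?f i = length r + ((a - i) + (i - a))" if "i < length p" for i
    using tree_dist_entry_path[OF assms(1-3) that] assms(4) by simp
  have "?b \<in> {..<length p}"
    unfolding closest_position_def using assms(3) by (intro arg_min_if_finite) auto
  moreover have "?f ?b \<le> ?f a"
    unfolding closest_position_def using assms(3) by (intro arg_min_least) auto
  ultimately show ?thesis
    using f[of ?b] f[OF assms(3)] by simp
qed

text \<open>Entering at \<open>a\<close>, following \<open>p\<close> to \<open>x\<close> and leaving
  along \<open>rev r\<close> repeats no vertex once the two entry paths are disjoint.\<close>

lemma tree_dist_between_entry_paths:
  assumes p: "vpath p T"
    and r: "entry_path p r (p ! x)" "x < length p"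
    and r': "entry_path p r' (p ! a)" "a < length p"
    and disj: "set r \<inter> set r' = {}"
  shows "tree_dist T (hd (r' @ [p ! a])) (hd (r @ [p ! x])) = length r' + ((a - x) + (x - a)) + length r"
proof -
  obtain s where s: "vpath s T" "hd s = p ! a" "last s = p ! x" "set s \<subseteq> set p"
      "length s = Suc ((a - x) + (x - a))"
    using vpath_segment[OF p r'(2) r(2)] by metis
  then have ne: "s \<noteq> []" by auto
  have 1: "vpath (r' @ s) T"
    using entry_path_append[OF r'(1) s(1,4,2)] .
  have "vpath (r @ rev s) T"
    using entry_path_append[OF r(1) vpath_rev[OF s(1)]] s(3,4) by (simp add: hd_rev)
  from vpath_rev[OF this] have 2: "vpath (s @ rev r) T"
    by simp
  have "vpath ((r' @ s) @ rev r) T"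
  proof (cases "r = []")
    case False
    have "distinct ((r' @ s) @ rev r)"
      using 1 2 disj by (auto simp: vpath_def)
    moreover have "vwalk ((r' @ s) @ rev r) T"
      using 1 2 vwalk_append_iff[of s "rev r" T] vwalk_append_iff[of "r' @ s" "rev r" T] False ne
      by (auto simp: vpath_def)
    ultimately show ?thesis by auto
  qed (use 1 in simp)
  from tree_dist_eq[OF this refl refl] show ?thesis
    using s ne by (cases "r = []"; cases "r' = []") (simp_all add: last_rev)
qed

section \<open>Components\<close>

lemma connected_induce_vpath:
  assumes "S \<subseteq> verts T" "u \<rightarrow>\<^sup>*\<^bsub>T \<restriction> S\<^esub> v"
  obtains p where "vpath p T" "set p \<subseteq> S" "hd p = u" "last p = v"
  using assms wf_digraph.reachable_vpath_conv[OF wellformed_induce_subgraph[of S], of u v]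
    vpath_induce_iff[OF assms(1)] by blast

lemma vwalk_reachable_induce:
  assumes "S \<subseteq> verts T" "vwalk p T" "set p \<subseteq> S"
  shows "hd p \<rightarrow>\<^sup>*\<^bsub>T \<restriction> S\<^esub> last p"
  using wf_digraph.reachable_vwalk_conv[OF wellformed_induce_subgraph[of S]]
    vwalk_induce_iff[OF assms(1)] assms by blast

text \<open>Cut a path in \<open>C\<close> from \<open>t\<close> to \<open>hd p\<close> at its first
  vertex on \<open>p\<close>.\<close>

lemma exists_entry_path:
  assumes C: "C \<subseteq> verts T" "strongly_connected (T \<restriction> C)"
    and p: "p \<noteq> []" "set p \<subseteq> C" and t: "t \<in> C"
  obtains r x where "entry_path p r (p ! x)" "x < length p" "hd (r @ [p ! x]) = t" "set r \<subseteq> C"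
proof -
  have "t \<rightarrow>\<^sup>*\<^bsub>T \<restriction> C\<^esub> hd p"
    using C(2) p(2) t hd_in_set[OF p(1)] by (auto simp: strongly_connected_def)
  then obtain w where w: "vpath w T" "set w \<subseteq> C" "hd w = t" "last w = hd p"
    using connected_induce_vpath[OF C(1)] by metis
  then have "w \<noteq> []"
    by (auto simp: vpath_def vwalk_def)
  then have "\<exists>v \<in> set w. v \<in> set p"
    using w(4) p(1) by (metis hd_in_set last_in_set)
  then obtain r z w' where rz: "w = r @ z # w'" "z \<in> set p" "\<forall>v\<in>set r. v \<notin> set p"
    by (auto elim!: split_list_first_propE)
  obtain x where x: "x < length p" "z = p ! x"
    using rz(2) by (metis in_set_conv_nth)
  have "vpath (r @ [z]) T"
    using w(1) vwalkI_append_l[of "r @ [z]" w' T] unfolding rz by (auto simp: vpath_def)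
  then have "entry_path p r z"
    using rz by (auto simp: entry_path_def)
  then show ?thesis
    using that[of r x] x w(2,3) rz by (auto simp: hd_append)
qed

lemma sym_digraph_induce: "S \<subseteq> verts T \<Longrightarrow> sym_digraph (T \<restriction> S)"
  using induced_graph_imp_graph by auto

text \<open>Meant for entry paths without their entry point: they avoid the spine and so stay in one
  component. It is named by the last vertex because that is the neighbour of the spine which the
  oracle reveals.\<close>

lemma vwalk_subset_component:
  assumes "S \<subseteq> verts T" "vwalk p T" "set p \<subseteq> S" "v \<in> set p"
  shows "v \<in> component_of (T \<restriction> S) (last p)"
proof -
  obtain p1 p2 where p: "p = p1 @ v # p2"
    using assms(4) by (meson split_list)
  then have "v \<rightarrow>\<^sup>*\<^bsub>T \<restriction> S\<^esub> last p"
    using vwalk_reachable_induce[OF assms(1), of "v # p2"] vwalkI_append_r[of "v # p2" p1 T] assms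
    by auto
  then show ?thesis
    using sym_digraph.scc_ofI_reachable[OF sym_digraph_induce[OF assms(1)]] by blast
qed

lemma component_induce_strongly_connected:
  assumes "S \<subseteq> verts T" "C \<in> components (T \<restriction> S)"
  shows "C \<subseteq> S" "strongly_connected (T \<restriction> C)"
proof -
  interpret S: wf_digraph "T \<restriction> S" by auto
  show "C \<subseteq> S"
    using S.sccs_verts_subsets[OF assms(2)] by simp
  then have "(T \<restriction> S) \<restriction> C = T \<restriction> C"
    by (auto simp: induce_subgraph_def)
  moreover interpret max_reachable_set "T \<restriction> S" C
    using assms(2) by unfold_locales
  show "strongly_connected (T \<restriction> C)"
    using strongly_connected calculation by simp
qed

text \<open>With two vertices, connectedness supplies an edge; a bag containing it has two elements,
  so the width is at least 1.\<close>

lemma pathwidth_0_imp_singleton: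
  assumes "C \<subseteq> verts T" "strongly_connected (T \<restriction> C)" "pathwidth (T \<restriction> C) = 0"
  shows "is_singleton C"
proof (rule ccontr)
  assume "\<not> is_singleton C"
  moreover have "C \<noteq> {}"
    using assms(2) by (simp add: strongly_connected_def)
  ultimately obtain u v where uv: "u \<in> C" "v \<in> C" "u \<noteq> v"
    by (metis is_singletonI')
  have fin: "finite C"
    using assms(1) finite_verts finite_subset by blast
  \<comment> \<open>The decomposition into one bag shows that the least width is attained.\<close>
  have "path_decomposition (T \<restriction> C) [C]"
    by (auto simp: path_decomposition_def arcs_ends_induce)
  then have "\<exists>w Bs. path_decomposition (T \<restriction> C) Bs \<and> decomposition_width Bs = w"
    by blast
  from LeastI_ex[OF this] obtain Bs
    where Bs: "path_decomposition (T \<restriction> C) Bs" "decomposition_width Bs = 0"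
    using assms(3) unfolding pathwidth_def by auto
  have "u \<rightarrow>\<^sup>*\<^bsub>T \<restriction> C\<^esub> v"
    using assms(2) uv by (auto simp: strongly_connected_def)
  then obtain p where p: "vpath p T" "set p \<subseteq> C" "hd p = u" "last p = v"
    using connected_induce_vpath[OF assms(1)] by metis
  obtain w p' where "p = u # w # p'"
    using p uv(3) by (cases p rule: vwalk_arcs.cases) (auto simp: vpath_def vwalk_def)
  then have w: "(u, w) \<in> arcs_ends (T \<restriction> C)" "u \<noteq> w"
    using p by (auto simp: arcs_ends_induce vpath_def)
  then obtain B where B: "B \<in> set Bs" "u \<in> B" "w \<in> B"
    using Bs(1) unfolding path_decomposition_def by blast
  have "B \<subseteq> C"
    using Bs(1) B(1) by (auto simp: path_decomposition_def)
  then have "card {u, w} \<le> card B"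
    using B fin by (intro card_mono) (auto intro: finite_subset)
  also have "card B \<le> Max (card ` set Bs)"
    using B(1) by (intro Max_ge) auto
  \<comment> \<open>The \<open>- 1\<close> in \<open>decomposition_width\<close> truncates, so width
    0 gives only this inequality.\<close>
  also have "\<dots> \<le> 1"
    using Bs(2) by (simp add: decomposition_width_def)
  finally show False
    using w(2) by simp
qed

section \<open>Spine exponential search\<close>

text \<open>Induction on a bound \<open>k\<close> for the pathwidth, which may drop by more than one
  in a round. A round costs at most \<open>2 * N + 2\<close> queries, and the distance bound
  \<open>2 ^ N\<close> passes on to the next. \<open>Some\<close> also records termination.\<close>

lemma spine_search_from_queries:
  assumes \<sigma>: "spine_decomposition T \<sigma>"
    and "C \<in> arising_components T \<sigma>" "C \<subseteq> verts T" "strongly_connected (T \<restriction> C)"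
    and "s \<in> C" "t \<in> C" "pathwidth (T \<restriction> C) \<le> k" "tree_dist T s t \<le> 2 ^ N"
  shows "\<exists>v q'. spine_search_from T (direction_oracle T t) \<sigma> C s q = Some (v, q + q')
    \<and> q' \<le> k * (2 * N + 2)"
  using assms(2-)
proof (induction k arbitrary: C s q)
  case 0
  then have "is_singleton C"
    using pathwidth_0_imp_singleton by simp
  then show ?case
    by (subst spine_search_from.simps) simp
next
  case (Suc k)
  note C = Suc.prems(1-3)
  show ?case
  proof (cases "is_singleton C")
    case True
    then show ?thesis
      by (subst spine_search_from.simps) simp
  next
    case False
    define p where "p = \<sigma> C"
    define S where "S = C - set p"
    let ?ask = "direction_oracle T t"
    have S: "S \<subseteq> verts T" "S \<subseteq> C"
      using C by (auto simp: S_def)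
    have spine: "is_spine (T \<restriction> C) (pathwidth (T \<restriction> C)) p"
      using \<sigma> C(1) False by (simp add: spine_decomposition_def p_def)
    then have p: "vpath p T" "set p \<subseteq> C"
      using vpath_induce_iff[OF C(2)] by (auto simp: is_spine_def)
    then have pne: "p \<noteq> []"
      by (auto simp: vpath_def vwalk_def)
    have width: "pathwidth (T \<restriction> C') \<le> k" if "C' \<in> components (T \<restriction> S)" for C'
    proof -
      have "C' \<subseteq> S"
        using component_induce_strongly_connected(1)[OF S(1) that] .
      \<comment> \<open>The property of the spine speaks of subgraphs of
        \<open>T \<restriction> C\<close>, the recursion of subgraphs of \<open>T\<close>.\<close>
      then have "(T \<restriction> C) \<restriction> C' = T \<restriction> C'" "(T \<restriction> C) \<restriction> S = T \<restriction> S"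
        using S(2) by (auto simp: induce_subgraph_def)
      then have "pathwidth (T \<restriction> C') \<le> pathwidth (T \<restriction> C) - 1"
        using spine that by (metis is_spine_def induce_subgraph_verts S_def)
      then show ?thesis
        using Suc.prems(6) by simp
    qed
    obtain r x where r: "entry_path p r (p ! x)" "x < length p" "hd (r @ [p ! x]) = t" "set r \<subseteq> C"
      using exists_entry_path[OF C(2,3) pne p(2) Suc.prems(5)] .
    obtain r' a where r': "entry_path p r' (p ! a)" "a < length p" "hd (r' @ [p ! a]) = s" "set r' \<subseteq> C"
      using exists_entry_path[OF C(2,3) pne p(2) Suc.prems(4)] .
    have a: "closest_position T p s = a"
      using closest_position_entry_path[OF p(1) r'(1-3)] .
    have dist: "tree_dist T s t = length r' + ((a - x) + (x - a)) + length r" if "set r \<inter> set r' = {}"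
      using tree_dist_between_entry_paths[OF p(1) r(1,2) r'(1,2) that] r(3) r'(3) by simp
    have "p ! x \<noteq> p ! a" if "x \<noteq> a"
      using that p(1) r(2) r'(2) by (auto simp: vpath_def nth_eq_iff_index_eq)
    \<comment> \<open>If \<open>x = a\<close> the left side is 0; otherwise the entry points differ,
      the entry paths are disjoint, and the distance formula applies.\<close>
    then have dist_spine: "(a - x) + (x - a) \<le> tree_dist T s t"
      using entry_paths_disjoint[OF p(1) r(1) r'(1)] dist by (cases "x = a") auto
    have fw: "points_to (path_move ?ask p) (length p) x"
      using path_move_points_to[OF p(1) r(1-3)] .
    have "rev p ! (length p - 1 - x) = p ! x"
      using r(2) by (simp add: rev_nth)
    then have bw: "points_to (path_move ?ask (rev p)) (length p) (length p - 1 - x)"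
      using path_move_points_to[OF vpath_rev[OF p(1)], of r "length p - 1 - x" t] r
      by (auto simp: entry_path_def)
    have "x \<le> a + 2 ^ N" "a \<le> x + 2 ^ N"
      using dist_spine Suc.prems(7) by linarith+
    then obtain q1 where q1: "q1 \<le> 2 * N + 2" "exponential_search ?ask p a = Some (p ! x, q1)"
      using exponential_search_queries[OF fw bw r'(2)] by blast
    show ?thesis
    proof (cases "r = []")
      case True
      then have "?ask (p ! x) = Here"
        using r(3) by (simp add: direction_oracle_def)
      then show ?thesis
        using False q1 a
        by (subst spine_search_from.simps) (auto simp: p_def[symmetric] intro: trans_le_add1)
    next
      case rne: False
      \<comment> \<open>The vertex just before the spine on the way from \<open>t\<close>, hence the
        oracle's answer at \<open>p ! x\<close>.\<close>
      define y where "y = last r"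
      define C' where "C' = component_of (T \<restriction> S) y"
      define s' where "s' = (if s \<in> C' then s else y)"
      have "t = hd r" using r(3) rne by simp
      then have tr: "t \<in> set r" "p ! x \<noteq> t"
        using rne r(1) by (auto simp: entry_path_def)
      have "tree_path T (p ! x) t = rev (r @ [p ! x])"
        using r(1,3) by (intro tree_path_eq vpath_rev) (auto simp: entry_path_def hd_rev last_rev)
      then have ask: "?ask (p ! x) = Toward y"
        using tr rne by (simp add: direction_oracle_def y_def nth_append rev_nth last_conv_nth)
      have rS: "set r \<subseteq> S" "set r' \<subseteq> S"
        using r(1,4) r'(1,4) by (auto simp: S_def entry_path_def)
      have wr: "vwalk r T"
        using r(1) rne vwalkI_append_l by (auto simp: entry_path_def vpath_def)
      have rC': "set r \<subseteq> C'"
        using vwalk_subset_component[OF S(1) wr rS(1)] unfolding C'_def y_def by auto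
      have yr: "y \<in> set r" using rne by (simp add: y_def)
      interpret S: wf_digraph "T \<restriction> S" by auto
      have comp: "C' \<in> components (T \<restriction> S)"
        unfolding C'_def using yr rS by (intro S.scc_of_in_sccs_verts) auto
      note C' = component_induce_strongly_connected[OF S(1) comp]
      have arising: "C' \<in> arising_components T \<sigma>"
        using arising_components.part[OF C(1) False] comp by (simp add: S_def p_def)
      have s': "s' \<in> C'"
        using yr rC' by (auto simp: s'_def)
      have dy: "tree_dist T y t = length r - 1"
      proof -
        have "vpath (rev r) T"
          using wr r(1) by (intro vpath_rev) (auto simp: entry_path_def vpath_def)
        from tree_dist_eq[OF this refl refl] show ?thesis
          using \<open>t = hd r\<close> rne by (simp add: y_def hd_rev last_rev)
      qed
      \<comment> \<open>Only a start vertex outside \<open>C'\<close> is replaced. Then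
        \<open>r\<close> and \<open>r'\<close> are disjoint, so the path from \<open>s\<close> to
        \<open>t\<close> contains all of \<open>r\<close>.\<close>
      have "tree_dist T y t \<le> tree_dist T s t" if "s \<notin> C'"
      proof -
        have "set r \<inter> set r' = {}"
        proof (rule ccontr)
          assume "set r \<inter> set r' \<noteq> {}"
          then obtain w where w: "w \<in> set r" "w \<in> set r'" by auto
          then have ne: "r' \<noteq> []" by auto
          have wr': "vwalk r' T"
            using r'(1) ne vwalkI_append_l by (auto simp: entry_path_def vpath_def)
          have "s \<in> set r'" using ne r'(3) by auto
          \<comment> \<open>\<open>r'\<close> avoids the spine, so \<open>s\<close> and
            \<open>w\<close> share a component, and \<open>w\<close> lies in
            \<open>C'\<close>.\<close>
          then have "s \<in> component_of (T \<restriction> S) (last r')" "w \<in> component_of (T \<restriction> S) (last r')"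
            using vwalk_subset_component[OF S(1) wr' rS(2)] w by auto
          moreover have "w \<in> component_of (T \<restriction> S) y"
            using w rC' by (auto simp: C'_def)
          ultimately have "s \<in> C'"
            unfolding C'_def using S.scc_of_eq by metis
          then show False using that by simp
        qed
        then show ?thesis
          using dist dy by simp
      qed
      then have "tree_dist T s' t \<le> 2 ^ N"
        using Suc.prems(7) by (auto simp: s'_def)
      then obtain v q2 where q2: "spine_search_from T ?ask \<sigma> C' s' (q + q1) = Some (v, q + q1 + q2)"
          "q2 \<le> k * (2 * N + 2)"
        using Suc.IH[OF arising _ C'(2) s' _ width[OF comp]] C'(1) S(1) rC' tr(1) by blast
      have "spine_search_from T ?ask \<sigma> C s q = Some (v, q + (q1 + q2))"
        using False q1(2) a ask q2(1)
        by (subst spine_search_from.simps)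
          (simp add: p_def[symmetric] S_def[symmetric] C'_def[symmetric] s'_def[symmetric] Let_def add.assoc)
      then show ?thesis
        using q1(1) q2(2) by (intro exI[of _ v] exI[of _ "q1 + q2"]) simp
    qed
  qed
qed

end

section \<open>From powers of two to logarithms\<close>

lemma ex_power2_bound:
  fixes D :: nat
  shows "\<exists>N. D \<le> 2 ^ N \<and> 2 * real N + 2 \<le> 6 * max 1 (log 2 (real D))"
proof (cases "D \<le> 1")
  case True
  \<comment> \<open>The maximum with 1 makes \<open>N = 0\<close> work whatever the logarithm
    is.\<close>
  then show ?thesis by (intro exI[of _ 0]) auto
next
  case False
  define N where "N = nat \<lceil>log 2 (real D)\<rceil>"
  have pos: "0 < log 2 (real D)" using False by simp
  have "log 2 (real D) \<le> real N"
    unfolding N_def by linarith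
  then have "real D \<le> 2 powr real N"
    using False by (simp add: log_le_iff)
  then have "real D \<le> real (2 ^ N)"
    by (simp add: powr_realpow)
  then have "D \<le> 2 ^ N"
    by (simp only: of_nat_le_iff)
  \<comment> \<open>Hence \<open>2 * N + 2\<close> is at most \<open>2 * log 2 D + 4\<close>. The
    maximum bounds both the logarithm and 1, which gives the constant 6 = 2 + 4.\<close>
  moreover have "real N \<le> log 2 (real D) + 1"
    unfolding N_def using pos by linarith
  ultimately show ?thesis
    by (intro exI[of _ N]) (auto simp: max_def)
qed

theorem theorem4:
  shows "\<exists>c :: real. c > 0 \<and>
    (\<forall>(T :: ('a, 'b) pre_digraph) \<sigma> s t.
       undirected_tree T \<and> spine_decomposition T \<sigma> \<and> s \<in> verts T \<and> t \<in> verts T \<longrightarrow>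
       (\<exists>v q. spine_exponential_search T \<sigma> s t = Some (v, q) \<and>
          real q \<le> c * real (pathwidth T) * max 1 (log 2 (real (tree_dist T s t)))))"
proof (intro exI[of _ 6] conjI allI impI)
  fix T :: "('a, 'b) pre_digraph" and \<sigma> s t
  assume A: "undirected_tree T \<and> spine_decomposition T \<sigma> \<and> s \<in> verts T \<and> t \<in> verts T"
  then interpret graph T
    by (simp add: undirected_tree_def)
  interpret tree_graph T
    using A by unfold_locales (force simp: undirected_tree_def)
  let ?L = "max 1 (log 2 (real (tree_dist T s t)))"
  \<comment> \<open>Identifies the initial component \<open>verts T\<close> with the tree itself,
    whose pathwidth is the initial bound.\<close>
  have whole: "T \<restriction> verts T = T"
    by (rule pre_digraph.equality) auto
  have "strongly_connected T"
    using A symmetric_connected_imp_strongly_connected[OF sym_arcs]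
    by (simp add: undirected_tree_def)
  moreover obtain N where N: "tree_dist T s t \<le> 2 ^ N" "2 * real N + 2 \<le> 6 * ?L"
    using ex_power2_bound by blast
  ultimately obtain v q where q: "spine_exponential_search T \<sigma> s t = Some (v, q)"
      "q \<le> pathwidth T * (2 * N + 2)"
    using spine_search_from_queries[of \<sigma> "verts T" s t "pathwidth T" N 0] A whole
    by (auto simp: spine_exponential_search_def intro: arising_components.whole)
  have "real q \<le> real (pathwidth T * (2 * N + 2))"
    using q(2) by (simp only: of_nat_le_iff)
  also have "\<dots> = real (pathwidth T) * (2 * real N + 2)"
    by (simp add: algebra_simps)
  also have "\<dots> \<le> real (pathwidth T) * (6 * ?L)"
    using N(2) by (intro mult_left_mono) auto
  finally have "real q \<le> 6 * real (pathwidth T) * ?L"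
    by (simp add: mult_ac)
  then show "\<exists>v q. spine_exponential_search T \<sigma> s t = Some (v, q) \<and> real q \<le> 6 * real (pathwidth T) * ?L"
    using q(1) by blast
qed simp

end
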